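(* Let $T=\{1234,1243,3412\}$ and let $F_T(x)=\sum_{n\ge0}|S_n(T)|x^n$. Then $$F_T(x)=\frac{1-9x+35x^2-75x^3+98x^4-78x^5+36x^6-12x^7}{(1-x)^6(1-2x)^2}.$$
   Context: $S_n$ is the set of permutations of $[n]=\{1,\dots,n\}$ ($S_0$ contains the empty permutation). A permutation $\pi$ contains a pattern $\tau\in S_k$ if some subsequence of $\pi$ of length $k$ is order-isomorphic to $\tau$; otherwise $\pi$ avoids $\tau$. For a set $T$ of patterns, $S_n(T)$ denotes the set of permutations in $S_n$ avoiding every pattern in $T$. *)

theory Defs
  imports
    "HOL-Library.Sublist"
    "HOL-Combinatorics.Multiset_Permutations"
    "HOL-Computational_Algebra.Formal_Power_Series"
begin

(* Permutations of {1..n} are written in one-line notation, as lists; the permutations of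
   length n are thus the elements of permutations_of_set {1..n}, and for n = 0 this is {[]}. *)

definition order_isomorphic :: "nat list \<Rightarrow> nat list \<Rightarrow> bool" where
  "order_isomorphic xs ys \<longleftrightarrow> length xs = length ys \<and>
     (\<forall>i<length xs. \<forall>j<length xs. xs ! i < xs ! j \<longleftrightarrow> ys ! i < ys ! j)"

(* subseq is the library's subsequence relation: the entries need not be contiguous. *)
definition contains_pattern :: "nat list \<Rightarrow> nat list \<Rightarrow> bool" where
  "contains_pattern p t \<longleftrightarrow> (\<exists>s. subseq s p \<and> order_isomorphic s t)"

definition avoiders :: "nat \<Rightarrow> nat list set \<Rightarrow> nat list set" where
  "avoiders n T = {p \<in> permutations_of_set {1..n}. \<forall>t\<in>T. \<not> contains_pattern p t}"

definition avoiders_gf :: "nat list set \<Rightarrow> rat fps" where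
  "avoiders_gf T = Abs_fps (\<lambda>n. of_nat (card (avoiders n T)))"

end

theory Submission
  imports Defs
begin

text \<open>
  A permutation of length \<open>n + 1\<close> arises from one of length \<open>n\<close> by inserting its maximum at a site.
  Insertion at \<open>s\<close> keeps the three patterns out iff no 123 has both of its first two letters before
  \<open>s\<close> and no 312 has its 3 before and its 12 after \<open>s\<close>.  How the admissible sites change depends only
  on their order and on two bits for each of them: whether the prefix before it, and the suffix
  after it, is decreasing.  Hence four families of states with at most two integer parameters
  suffice, the succession rule being
    \<^item> \<open>decr m \<rightarrow> decr (m + 1), sep (1, m), \<dots>, sep (m, 1)\<close>
    \<^item> \<open>sep (a, r) \<rightarrow> sep (1, r), gap (2, r + 1), \<dots>, gap (a, r + 1), sep (a, r + 1), pre (a + 1)\<^sup>r\<close>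
    \<^item> \<open>gap (a, d) \<rightarrow> gap (1, d), \<dots>, gap (a, d), pre (a)\<^sup>d\<close>
    \<^item> \<open>pre a \<rightarrow> pre 1, \<dots>, pre a\<close>
  and the generating functions of the subtrees solve the resulting linear system, whose solutions
  are polynomial in the parameters and in powers of \<open>1 / (1 - x)\<close>.
\<close>

section \<open>The three patterns in terms of ascents and 312s\<close>

definition ascent :: "nat list \<Rightarrow> nat \<Rightarrow> nat \<Rightarrow> bool" where
  "ascent p i j \<longleftrightarrow> i < j \<and> j < length p \<and> p ! i < p ! j"

definition pattern_312 :: "nat list \<Rightarrow> nat \<Rightarrow> nat \<Rightarrow> nat \<Rightarrow> bool" where
  "pattern_312 p i k l \<longleftrightarrow> i < k \<and> ascent p k l \<and> p ! l < p ! i"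

text \<open>1234 and 1243 differ only in the order of the last two letters: together they forbid an
  ascent whose top has two larger letters after it. A 3412 is a 312 with a letter above its 3 placed
  before its 1. Every quantifier is guarded by \<open>ascent\<close> or \<open>pattern_312\<close>,
  so an insertion can be pushed through.\<close>

definition avoids :: "nat list \<Rightarrow> bool" where
  "avoids p \<longleftrightarrow>
     (\<forall>i j. ascent p i j \<longrightarrow> (\<forall>k. ascent p j k \<longrightarrow> (\<forall>l. ascent p j l \<longrightarrow> l = k))) \<and>
     (\<forall>i k l. pattern_312 p i k l \<longrightarrow> (\<forall>j. ascent p i j \<longrightarrow> k \<le> j))"

lemma subseq_Cons_drop_iff:
  "subseq (x # xs) (drop m p) \<longleftrightarrow>
     (\<exists>i\<ge>m. i < length p \<and> p ! i = x \<and> subseq xs (drop (Suc i) p))"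
proof
  assume "subseq (x # xs) (drop m p)"
  then obtain us vs where h: "drop m p = us @ x # vs" "subseq xs vs"
    by (auto dest: list_emb_ConsD)
  let ?i = "m + length us"
  have m: "m \<le> length p"
    using h(1) by (metis Nil_is_append_conv drop_all list.discI nat_le_linear)
  have "?i < length p"
    using arg_cong[OF h(1), of length] by simp
  moreover have "p ! ?i = x"
    using arg_cong[OF h(1), of "\<lambda>q. q ! length us"] m by simp
  moreover have "drop (Suc ?i) p = vs"
    using arg_cong[OF h(1), of "drop (Suc (length us))"] by (simp add: add_ac)
  ultimately show "\<exists>i\<ge>m. i < length p \<and> p ! i = x \<and> subseq xs (drop (Suc i) p)"
    using h(2) by (intro exI[of _ ?i]) simp
next
  assume "\<exists>i\<ge>m. i < length p \<and> p ! i = x \<and> subseq xs (drop (Suc i) p)"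
  then obtain i where i: "m \<le> i" "i < length p" "p ! i = x" "subseq xs (drop (Suc i) p)"
    by blast
  then have "subseq (x # xs) (drop i p)"
    by (metis Cons_nth_drop_Suc subseq_Cons2)
  moreover have "drop i p = drop (i - m) (drop m p)"
    using i by simp
  ultimately show "subseq (x # xs) (drop m p)"
    by (metis append_take_drop_id list_emb_append2)
qed

lemma subseq_four_iff:
  "subseq [a, b, c, d] p \<longleftrightarrow>
     (\<exists>i j k l. i < j \<and> j < k \<and> k < l \<and> l < length p \<and> a = p ! i \<and> b = p ! j \<and> c = p ! k \<and> d = p ! l)"
  (is "_ \<longleftrightarrow> ?R")
proof
  assume "subseq [a, b, c, d] p"
  then have "subseq [a, b, c, d] (drop 0 p)"
    by simp
  then obtain i j k l where "i < j" "j < k" "k < l" "l < length p"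
    "p ! i = a" "p ! j = b" "p ! k = c" "p ! l = d"
    unfolding subseq_Cons_drop_iff Suc_le_eq by (elim exE conjE)
  then show ?R
    by (intro exI[of _ i] exI[of _ j] exI[of _ k] exI[of _ l] conjI) simp_all
next
  assume ?R
  then obtain i j k l where "i < j" "j < k" "k < l" "l < length p"
    "a = p ! i" "b = p ! j" "c = p ! k" "d = p ! l"
    by blast
  then have "subseq [a, b, c, d] (drop 0 p)"
    unfolding subseq_Cons_drop_iff Suc_le_eq
    by (intro exI[of _ i] exI[of _ j] exI[of _ k] exI[of _ l] conjI) simp_all
  then show "subseq [a, b, c, d] p"
    by simp
qed

lemma contains_pattern_four_iff:
  "contains_pattern p [w, x, y, z] \<longleftrightarrow>
     (\<exists>i j k l. i < j \<and> j < k \<and> k < l \<and> l < length p \<and>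
        order_isomorphic [p ! i, p ! j, p ! k, p ! l] [w, x, y, z])"
proof -
  have "order_isomorphic s [w, x, y, z] \<Longrightarrow> \<exists>a b c d. s = [a, b, c, d]" for s
    by (auto simp: order_isomorphic_def length_Suc_conv)
  then have "contains_pattern p [w, x, y, z] \<longleftrightarrow>
      (\<exists>a b c d. subseq [a, b, c, d] p \<and> order_isomorphic [a, b, c, d] [w, x, y, z])"
    unfolding contains_pattern_def by blast
  then show ?thesis
    unfolding subseq_four_iff by blast
qed

text \<open>Distinctness decides between 1234 and 1243: two larger letters after an ascent top are
  unequal, hence rise or fall.\<close>

lemma avoids_iff:
  assumes "distinct p"
  shows "avoids p \<longleftrightarrow> (\<forall>t\<in>{[1,2,3,4], [1,2,4,3], [3,4,1,2]}. \<not> contains_pattern p t)"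
proof -
  have neq: "p ! i \<noteq> p ! j" if "i < j" "j < length p" for i j
    using that assms by (simp add: nth_eq_iff_index_eq)
  have 1: "order_isomorphic [a, b, c, d] [1, 2, 3, 4] \<longleftrightarrow> a < b \<and> b < c \<and> c < d" for a b c d
    by (auto simp: order_isomorphic_def All_less_Suc2)
  have 2: "order_isomorphic [a, b, c, d] [1, 2, 4, 3] \<longleftrightarrow> a < b \<and> b < d \<and> d < c" for a b c d
    by (auto simp: order_isomorphic_def All_less_Suc2)
  have 3: "order_isomorphic [a, b, c, d] [3, 4, 1, 2] \<longleftrightarrow> c < d \<and> d < a \<and> a < b" for a b c d
    by (auto simp: order_isomorphic_def All_less_Suc2)
  have "(\<exists>i j k l. ascent p i j \<and> ascent p j k \<and> ascent p j l \<and> k < l) \<longleftrightarrow>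
      contains_pattern p [1,2,3,4] \<or> contains_pattern p [1,2,4,3]"
    unfolding contains_pattern_four_iff 1 2 ascent_def
    by (meson less_trans linorder_neqE_nat neq)
  moreover have "(\<forall>i j. ascent p i j \<longrightarrow> (\<forall>k. ascent p j k \<longrightarrow> (\<forall>l. ascent p j l \<longrightarrow> l = k))) \<longleftrightarrow>
      \<not> (\<exists>i j k l. ascent p i j \<and> ascent p j k \<and> ascent p j l \<and> k < l)"
    by (metis nat_neq_iff)
  ultimately have A: "(\<forall>i j. ascent p i j \<longrightarrow> (\<forall>k. ascent p j k \<longrightarrow> (\<forall>l. ascent p j l \<longrightarrow> l = k))) \<longleftrightarrow>
      \<not> (contains_pattern p [1,2,3,4] \<or> contains_pattern p [1,2,4,3])"
    by argo
  have "(\<exists>i j k l. ascent p i j \<and> j < k \<and> pattern_312 p i k l) \<longleftrightarrow>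
      contains_pattern p [3,4,1,2]"
    unfolding contains_pattern_four_iff 3 ascent_def pattern_312_def
    by (meson less_trans)
  moreover have "(\<forall>i k l. pattern_312 p i k l \<longrightarrow> (\<forall>j. ascent p i j \<longrightarrow> k \<le> j)) \<longleftrightarrow>
      \<not> (\<exists>i j k l. ascent p i j \<and> j < k \<and> pattern_312 p i k l)"
    by (metis not_le)
  ultimately have B: "(\<forall>i k l. pattern_312 p i k l \<longrightarrow> (\<forall>j. ascent p i j \<longrightarrow> k \<le> j)) \<longleftrightarrow>
      \<not> contains_pattern p [3,4,1,2]"
    by argo
  show ?thesis
    unfolding avoids_def A B by auto
qed

section \<open>Inserting the maximum and its effect on the sites\<close>

definition insert_max :: "nat list \<Rightarrow> nat \<Rightarrow> nat list" where
  "insert_max p s = take s p @ Suc (length p) # drop s p"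

text \<open>
  The sites at which the maximum may be inserted, those with a decreasing prefix before them, and
  those with a decreasing suffix after them.
\<close>

definition sites :: "nat list \<Rightarrow> nat set" where
  "sites p = {s. s \<le> length p \<and>
     (\<forall>i j. ascent p i j \<longrightarrow> (\<forall>k. ascent p j k \<longrightarrow> s \<le> j)) \<and>
     (\<forall>i k l. pattern_312 p i k l \<longrightarrow> i < s \<longrightarrow> k < s)}"

definition pre_sites :: "nat list \<Rightarrow> nat set" where
  "pre_sites p = {s. s \<le> length p \<and> (\<forall>i j. ascent p i j \<longrightarrow> s \<le> j)}"

definition suf_sites :: "nat list \<Rightarrow> nat set" where
  "suf_sites p = {s. s \<le> length p \<and> (\<forall>i j. ascent p i j \<longrightarrow> i < s)}"

definition bounded_list :: "nat list \<Rightarrow> bool" where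
  "bounded_list p \<longleftrightarrow> (\<forall>x\<in>set p. x \<le> length p)"

lemma length_insert_max [simp]: "length (insert_max p s) = Suc (length p)"
  by (simp add: insert_max_def)

lemma bounded_insert_max: "bounded_list p \<Longrightarrow> bounded_list (insert_max p s)"
  by (auto simp: bounded_list_def insert_max_def dest!: in_set_takeD in_set_dropD)

text \<open>The old index of position \<open>i \<noteq> s\<close> after an insertion at \<open>s\<close>.\<close>

definition skip :: "nat \<Rightarrow> nat \<Rightarrow> nat" where
  "skip s i = (if i < s then i else i - 1)"

lemma nth_insert_max:
  assumes "s \<le> length p" "i \<le> length p"
  shows "insert_max p s ! i = (if i = s then Suc (length p) else p ! skip s i)"
  using assms by (cases "i - s") (auto simp: insert_max_def skip_def nth_append min_def intro!: arg_cong[where f = "nth p"])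

text \<open>The new letter exceeds all others, so it ends an ascent from every earlier position and
  starts none; other pairs keep their order.\<close>

lemma ascent_insert_max:
  assumes "bounded_list p" "s \<le> length p"
  shows "ascent (insert_max p s) i j \<longleftrightarrow>
    j = s \<and> i < s \<or> i \<noteq> s \<and> j \<noteq> s \<and> ascent p (skip s i) (skip s j)"
proof -
  have le: "p ! i \<le> length p" if "i < length p" for i
    using that assms by (auto simp: bounded_list_def)
  consider "j > length p" | "j \<le> length p" "j = s" "i < s" | "j \<le> length p" "j \<noteq> s" "i = s"
    | "j \<le> length p" "j \<noteq> s" "i \<noteq> s" | "i \<ge> j" by linarith
  then show ?thesis
  proof cases
    case 1
    then show ?thesis using assms by (auto simp: ascent_def skip_def)
  next
    case 2
    then have "p ! i < Suc (length p)" using assms le[of i] by simp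
    then show ?thesis using 2 assms by (simp add: ascent_def nth_insert_max skip_def)
  next
    case 3
    then have "p ! skip s j < Suc (length p)" if "i < j"
    using that by (intro le_imp_less_Suc le) (auto simp: skip_def)
    then show ?thesis using 3 assms by (auto simp: ascent_def nth_insert_max)
  next
    case 4
    have "i < j \<Longrightarrow> skip s i < skip s j" "skip s i < skip s j \<Longrightarrow> i < j" "skip s j < length p"
      using 4 assms by (auto simp: skip_def split: if_splits)
    then show ?thesis using 4 assms by (auto simp: ascent_def nth_insert_max)
  next
    case 5
    then show ?thesis by (auto simp: ascent_def skip_def split: if_splits)
  qed
qed

text \<open>The inverse of \<open>skip s\<close>, with range the positions other than \<open>s\<close>.\<close>

definition shift :: "nat \<Rightarrow> nat \<Rightarrow> nat" where
  "shift s i = (if i < s then i else Suc i)"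

lemma all_shift_iff: "(\<forall>i. Q i) \<longleftrightarrow> Q s \<and> (\<forall>i. Q (shift s i))"
proof -
  have "i = s \<or> i = shift s (skip s i)" for i
    by (auto simp: shift_def skip_def)
  then show ?thesis by metis
qed

lemma shift_simps [simp]:
  "shift s i \<noteq> s" "s \<noteq> shift s i" "skip s (shift s i) = i"
  "shift s i = shift s j \<longleftrightarrow> i = j" "shift s i \<le> shift s j \<longleftrightarrow> i \<le> j" "shift s i \<le> s \<longleftrightarrow> i < s"
  "shift s i < shift s j \<longleftrightarrow> i < j" "shift s i < s \<longleftrightarrow> i < s" "s < shift s i \<longleftrightarrow> s \<le> i"
  by (auto simp: shift_def skip_def)

text \<open>Site \<open>s\<close> is doubled into \<open>s\<close> and \<open>Suc s\<close>, on
  either side of the new maximum; later sites move up by one. Hence the insertion lemmas come in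
  pairs, for \<open>t \<le> s\<close> and for \<open>Suc t\<close> with
  \<open>s \<le> t\<close>.\<close>

lemma shift_le: "t \<le> s \<Longrightarrow> t \<le> shift s i \<longleftrightarrow> t \<le> i" "t \<le> s \<Longrightarrow> shift s i < t \<longleftrightarrow> i < t"
  "s \<le> t \<Longrightarrow> Suc t \<le> shift s i \<longleftrightarrow> t \<le> i" "s \<le> t \<Longrightarrow> shift s i < Suc t \<longleftrightarrow> i < t"
  by (auto simp: shift_def)

lemma ascent_insert_max_simps:
  assumes "bounded_list p" "s \<le> length p"
  shows "ascent (insert_max p s) (shift s i) (shift s j) \<longleftrightarrow> ascent p i j"
    "ascent (insert_max p s) (shift s i) s \<longleftrightarrow> i < s"
    "ascent (insert_max p s) s j \<longleftrightarrow> False"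
  by (auto simp: ascent_insert_max[OF assms])

lemma nth_insert_max_simps:
  assumes "s \<le> length p"
  shows "i < length p \<Longrightarrow> insert_max p s ! shift s i = p ! i"
    "insert_max p s ! s = Suc (length p)"
  using assms by (auto simp: nth_insert_max shift_def skip_def)

lemma ascent_less: "ascent p i j \<Longrightarrow> i < j" "ascent p i j \<Longrightarrow> i < length p" "ascent p i j \<Longrightarrow> j < length p"
  by (auto simp: ascent_def)

lemma pattern_312_insert_max_simps:
  assumes "bounded_list p" "s \<le> length p"
  shows "pattern_312 (insert_max p s) (shift s i) (shift s k) (shift s l) \<longleftrightarrow> pattern_312 p i k l"
    "pattern_312 (insert_max p s) s (shift s k) (shift s l) \<longleftrightarrow> s \<le> k \<and> ascent p k l"
    "pattern_312 (insert_max p s) i k s \<longleftrightarrow> False"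
    "pattern_312 (insert_max p s) i s l \<longleftrightarrow> False"
proof -
  note simps = pattern_312_def ascent_insert_max_simps[OF assms] nth_insert_max_simps[OF assms(2)]
  have le: "p ! i \<le> length p" if "i < length p" for i
    using that assms by (auto simp: bounded_list_def)
  show "pattern_312 (insert_max p s) (shift s i) (shift s k) (shift s l) \<longleftrightarrow> pattern_312 p i k l"
    using ascent_less[of p k l] by (auto simp: simps)
  show "pattern_312 (insert_max p s) s (shift s k) (shift s l) \<longleftrightarrow> s \<le> k \<and> ascent p k l"
    using ascent_less[of p k l] le[of l] by (auto simp: simps)
  show "pattern_312 (insert_max p s) i s l \<longleftrightarrow> False"
    by (simp add: simps)
  have "i = s \<or> i = shift s (skip s i)"
    by (auto simp: shift_def skip_def)
  then show "pattern_312 (insert_max p s) i k s \<longleftrightarrow> False"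
    using assms le[of "skip s i"] by (auto simp: pattern_312_def nth_insert_max ascent_def skip_def)
qed

text \<open>A condition on the longer list becomes the same condition on the old positions plus one
  on the ascents or 312s through the maximum.\<close>

lemma all_ascent_insert_max_iff:
  assumes "bounded_list p" "s \<le> length p"
  shows "(\<forall>i j. ascent (insert_max p s) i j \<longrightarrow> R i j) \<longleftrightarrow>
      (\<forall>i<s. R i s) \<and> (\<forall>i j. ascent p i j \<longrightarrow> R (shift s i) (shift s j))"
    "(\<forall>j. ascent (insert_max p s) (shift s i) j \<longrightarrow> R' j) \<longleftrightarrow>
      (i < s \<longrightarrow> R' s) \<and> (\<forall>j. ascent p i j \<longrightarrow> R' (shift s j))"
    "(\<forall>i k l. pattern_312 (insert_max p s) i k l \<longrightarrow> R3 i k l) \<longleftrightarrow>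
      (\<forall>k l. s \<le> k \<longrightarrow> ascent p k l \<longrightarrow> R3 s (shift s k) (shift s l)) \<and>
      (\<forall>i k l. pattern_312 p i k l \<longrightarrow> R3 (shift s i) (shift s k) (shift s l))"
proof -
  note simps = ascent_insert_max_simps[OF assms] pattern_312_insert_max_simps[OF assms]
  have shift_less: "i < s \<Longrightarrow> shift s i = i" for i
    by (simp add: shift_def)
  have "(\<forall>i j. ascent (insert_max p s) i j \<longrightarrow> R i j) \<longleftrightarrow>
      (\<forall>j. ascent (insert_max p s) s j \<longrightarrow> R s j) \<and>
      (\<forall>i. ascent (insert_max p s) (shift s i) s \<longrightarrow> R (shift s i) s) \<and>
      (\<forall>i j. ascent (insert_max p s) (shift s i) (shift s j) \<longrightarrow> R (shift s i) (shift s j))"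
    by (subst all_shift_iff[where s = s], subst (2) all_shift_iff[where s = s]) blast
  then show "(\<forall>i j. ascent (insert_max p s) i j \<longrightarrow> R i j) \<longleftrightarrow>
      (\<forall>i<s. R i s) \<and> (\<forall>i j. ascent p i j \<longrightarrow> R (shift s i) (shift s j))"
    by (simp add: simps shift_less)
  show "(\<forall>j. ascent (insert_max p s) (shift s i) j \<longrightarrow> R' j) \<longleftrightarrow>
      (i < s \<longrightarrow> R' s) \<and> (\<forall>j. ascent p i j \<longrightarrow> R' (shift s j))"
    by (subst all_shift_iff[where s = s]) (simp add: simps)
  have "(\<forall>k l. pattern_312 (insert_max p s) i k l \<longrightarrow> R3 i k l) \<longleftrightarrow>
      (\<forall>k l. pattern_312 (insert_max p s) i (shift s k) (shift s l) \<longrightarrow> R3 i (shift s k) (shift s l))" for i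
    by (subst all_shift_iff[where s = s], subst (2) all_shift_iff[where s = s]) (simp add: simps)
  then show "(\<forall>i k l. pattern_312 (insert_max p s) i k l \<longrightarrow> R3 i k l) \<longleftrightarrow>
      (\<forall>k l. s \<le> k \<longrightarrow> ascent p k l \<longrightarrow> R3 s (shift s k) (shift s l)) \<and>
      (\<forall>i k l. pattern_312 p i k l \<longrightarrow> R3 (shift s i) (shift s k) (shift s l))"
    by (subst all_shift_iff[where s = s]) (simp add: simps, blast)
qed

text \<open>A prefix reaching past the maximum can decrease only if the maximum comes first.\<close>

lemma pre_sites_insert_max:
  assumes "bounded_list p" "s \<le> length p"
  shows "t \<le> s \<Longrightarrow> t \<in> pre_sites (insert_max p s) \<longleftrightarrow> t \<in> pre_sites p"
    "s \<le> t \<Longrightarrow> Suc t \<in> pre_sites (insert_max p s) \<longleftrightarrow> s = 0 \<and> t \<in> pre_sites p"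
  using assms(2) unfolding pre_sites_def mem_Collect_eq all_ascent_insert_max_iff[OF assms]
  by (auto simp: shift_le)

text \<open>A suffix starting before the maximum has an ascent up to it; one starting with it
  decreases iff the remainder does.\<close>

lemma suf_sites_insert_max:
  assumes "bounded_list p" "s \<le> length p"
  shows "t \<le> s \<Longrightarrow> t \<in> suf_sites (insert_max p s) \<longleftrightarrow> t = s \<and> s \<in> suf_sites p"
    "s \<le> t \<Longrightarrow> Suc t \<in> suf_sites (insert_max p s) \<longleftrightarrow> t \<in> suf_sites p"
  using assms(2) unfolding suf_sites_def mem_Collect_eq all_ascent_insert_max_iff[OF assms]
  by (auto simp: shift_le intro: le_antisym dest: leI)

text \<open>For \<open>t \<le> s\<close>, an ascent before \<open>t\<close> forms a 123 with the
  maximum, so the prefix must decrease. For a site beyond the maximum, an ascent before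
  \<open>s\<close> does the same, and an ascent starting at \<open>t\<close> or later forms a 312
  whose 3, the maximum, is cut off from its 12 by the site.\<close>

lemma sites_insert_max:
  assumes "bounded_list p" "s \<le> length p"
  shows "t \<le> s \<Longrightarrow> t \<in> sites (insert_max p s) \<longleftrightarrow> t \<in> sites p \<and> t \<in> pre_sites p"
    "s \<le> t \<Longrightarrow> Suc t \<in> sites (insert_max p s) \<longleftrightarrow>
       t \<in> sites p \<and> s \<in> pre_sites p \<and> t \<in> suf_sites p"
proof -
  note simps = sites_def mem_Collect_eq all_ascent_insert_max_iff[OF assms]
    ascent_insert_max_simps(3)[OF assms]
  assume t: "t \<le> s"
  have "t \<in> sites (insert_max p s) \<longleftrightarrow> t \<le> length p \<and>
      (\<forall>i j. ascent p i j \<longrightarrow> (j < s \<longrightarrow> t \<le> j) \<and> (\<forall>k. ascent p j k \<longrightarrow> t \<le> j)) \<and>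
      (\<forall>i k l. pattern_312 p i k l \<longrightarrow> i < t \<longrightarrow> k < t)"
    using t assms(2) unfolding simps by (simp add: shift_le del: all_simps ex_simps)
  also have "\<dots> \<longleftrightarrow> t \<in> sites p \<and> t \<in> pre_sites p"
    using t unfolding sites_def pre_sites_def mem_Collect_eq
    by (meson le_trans linorder_le_less_linear)
  finally show "t \<in> sites (insert_max p s) \<longleftrightarrow> t \<in> sites p \<and> t \<in> pre_sites p" .
next
  note simps = sites_def mem_Collect_eq all_ascent_insert_max_iff[OF assms]
    ascent_insert_max_simps(3)[OF assms]
  assume t: "s \<le> t"
  have "Suc t \<in> sites (insert_max p s) \<longleftrightarrow> t \<le> length p \<and>
      (\<forall>i j. ascent p i j \<longrightarrow> \<not> j < s \<and> (\<forall>k. ascent p j k \<longrightarrow> t \<le> j)) \<and>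
      (\<forall>k l. s \<le> k \<longrightarrow> ascent p k l \<longrightarrow> k < t) \<and>
      (\<forall>i k l. pattern_312 p i k l \<longrightarrow> i < t \<longrightarrow> k < t)"
    using t assms(2) unfolding simps by (auto simp add: shift_le simp del: all_simps ex_simps)
  also have "\<dots> \<longleftrightarrow> t \<in> sites p \<and> s \<in> pre_sites p \<and> t \<in> suf_sites p"
  proof -
    have "(\<forall>k l. s \<le> k \<longrightarrow> ascent p k l \<longrightarrow> k < t) \<longleftrightarrow> (\<forall>k l. ascent p k l \<longrightarrow> k < t)"
      using t by (metis less_le_trans not_le)
    then show ?thesis
      using assms(2) unfolding sites_def pre_sites_def suf_sites_def mem_Collect_eq not_less
      by blast
  qed
  finally show "Suc t \<in> sites (insert_max p s) \<longleftrightarrow>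
       t \<in> sites p \<and> s \<in> pre_sites p \<and> t \<in> suf_sites p" .
qed

text \<open>A new occurrence uses the maximum as its 4. In 1234 and 1243 it extends a 123 whose
  first two letters precede \<open>s\<close>; in 3412 it stands between the 3 and the 1 of a
  312.\<close>

lemma avoids_insert_max:
  assumes "bounded_list p" "s \<le> length p"
  shows "avoids (insert_max p s) \<longleftrightarrow> avoids p \<and> s \<in> sites p"
proof -
  have "avoids (insert_max p s) \<longleftrightarrow>
      (\<forall>i j. ascent p i j \<longrightarrow>
         (\<forall>k. ascent p j k \<longrightarrow> s \<le> j \<and> (\<forall>l. ascent p j l \<longrightarrow> l = k))) \<and>
      (\<forall>i k l. pattern_312 p i k l \<longrightarrow> (i < s \<longrightarrow> k < s) \<and> (\<forall>j. ascent p i j \<longrightarrow> k \<le> j))"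
    unfolding avoids_def all_ascent_insert_max_iff[OF assms] ascent_insert_max_simps(3)[OF assms]
    by (simp del: all_simps ex_simps add: not_less[symmetric], auto)
  then show ?thesis using assms(2) unfolding avoids_def sites_def by blast
qed

section \<open>The generating tree of avoiding permutations\<close>

definition avoiding_perms :: "nat \<Rightarrow> nat list set" where
  "avoiding_perms n = {p \<in> permutations_of_set {1..n}. avoids p}"

lemma avoiders_eq: "avoiders n {[1,2,3,4], [1,2,4,3], [3,4,1,2]} = avoiding_perms n"
  unfolding avoiders_def avoiding_perms_def using avoids_iff permutations_of_setD(2) by blast

lemma avoiding_perms_props:
  assumes "p \<in> avoiding_perms n"
  shows "length p = n" "set p = {1..n}" "distinct p" "bounded_list p" "avoids p"
proof -
  have "length p = n"
    using assms length_finite_permutations_of_set[of p "{1..n}"] by (simp add: avoiding_perms_def)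
  moreover show "set p = {1..n}" "distinct p" "avoids p"
    using assms by (simp_all add: avoiding_perms_def permutations_of_set_def)
  ultimately show "length p = n" "bounded_list p"
    by (simp_all add: bounded_list_def)
qed

lemma sites_le: "s \<in> sites p \<Longrightarrow> s \<le> length p"
  by (simp add: sites_def)

lemma finite_sites [simp]: "finite (sites p)"
  by (rule finite_subset[of _ "{..length p}"]) (auto dest: sites_le)

lemma inj_insert_max:
  assumes "bounded_list p" "bounded_list q" "s \<le> length p" "t \<le> length q"
    and "insert_max p s = insert_max q t"
  shows "p = q \<and> s = t"
proof -
  have len: "length p = length q"
    using assms(5) length_insert_max by (metis nat.inject)
  have "s = t"
  proof (rule ccontr)
    assume "s \<noteq> t"
    \<comment> \<open>Otherwise position \<open>s\<close> of \<open>insert_max q t\<close> holds an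
      old letter, which is too small.\<close>
    then have "skip t s < length q"
      using assms(3,4) len by (auto simp: skip_def)
    then have "q ! skip t s \<le> length q"
      using assms(2) by (simp add: bounded_list_def)
    then have "insert_max p s ! s \<noteq> insert_max q t ! s"
      using nth_insert_max[of s p s] nth_insert_max[of t q s] assms(3,4) len \<open>s \<noteq> t\<close> by simp
    then show False using assms(5) by simp
  qed
  moreover have "take s p = take t q \<and> drop s p = drop t q"
    using assms(3,4,5) len \<open>s = t\<close> by (simp add: insert_max_def)
  ultimately show ?thesis
    by (metis append_take_drop_id)
qed

lemma avoiding_perms_Suc:
  "avoiding_perms (Suc n) = (\<lambda>(p, s). insert_max p s) ` Sigma (avoiding_perms n) sites"
proof (intro equalityI subsetI)
  fix q assume q: "q \<in> avoiding_perms (Suc n)"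
  then obtain ys zs where q_eq: "q = ys @ Suc n # zs"
    using avoiding_perms_props(2)[OF q] split_list[of "Suc n" q] by auto
  let ?p = "ys @ zs"
  have len: "length ?p = n"
    using avoiding_perms_props(1)[OF q] q_eq by simp
  then have q': "q = insert_max ?p (length ys)"
    by (simp add: insert_max_def q_eq)
  have "distinct ?p" "Suc n \<notin> set ?p" "insert (Suc n) (set ?p) = {1..Suc n}"
    using avoiding_perms_props(2,3)[OF q] by (auto simp: q_eq)
  moreover have "{1..Suc n} = insert (Suc n) {1..n}"
    by auto
  ultimately have p: "distinct ?p" "set ?p = {1..n}"
    using insert_ident[of "Suc n" "set ?p" "{1..n}"] by (simp_all del: set_append)
  then have "bounded_list ?p"
    using len by (simp add: bounded_list_def)
  then have "avoids ?p" "length ys \<in> sites ?p"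
    using avoids_insert_max[of ?p "length ys"] avoiding_perms_props(5)[OF q] q' by simp_all
  then have "?p \<in> avoiding_perms n" "length ys \<in> sites ?p"
    using p by (simp_all add: avoiding_perms_def permutations_of_set_def)
  then show "q \<in> (\<lambda>(p, s). insert_max p s) ` Sigma (avoiding_perms n) sites"
    using q' by (intro image_eqI[of _ _ "(?p, length ys)"]) auto
next
  fix q assume "q \<in> (\<lambda>(p, s). insert_max p s) ` Sigma (avoiding_perms n) sites"
  then obtain p s where h: "q = insert_max p s" "p \<in> avoiding_perms n" "s \<in> sites p"
    by auto
  note p = avoiding_perms_props[OF h(2)]
  have "avoids q"
    using avoids_insert_max[OF p(4) sites_le[OF h(3)]] h p by simp
  moreover have "set (take s p) \<union> set (drop s p) = {1..n}"
    using p(2) by (metis append_take_drop_id set_append)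
  moreover have "Suc n \<notin> set (take s p)" "Suc n \<notin> set (drop s p)"
    using p(2) in_set_takeD[of "Suc n" s p] in_set_dropD[of "Suc n" s p] by auto
  moreover have "distinct (take s p @ drop s p)"
    using p(3) by simp
  ultimately show "q \<in> avoiding_perms (Suc n)"
    using p(1) unfolding avoiding_perms_def mem_Collect_eq h(1) permutations_of_set_def insert_max_def
    by (auto simp: atLeastAtMostSuc_conv simp del: append_take_drop_id)
qed

fun descendants :: "nat \<Rightarrow> nat list \<Rightarrow> nat" where
  "descendants 0 p = 1"
| "descendants (Suc n) p = (\<Sum>s\<in>sites p. descendants n (insert_max p s))"

lemma finite_avoiding_perms [simp]: "finite (avoiding_perms n)"
  by (simp add: avoiding_perms_def)

text \<open>Insertion is injective, so the children of level \<open>m\<close> make up level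
  \<open>Suc m\<close> without repetition; one level is absorbed at a time.\<close>

lemma sum_descendants: "(\<Sum>p\<in>avoiding_perms m. descendants n p) = card (avoiding_perms (m + n))"
proof (induction n arbitrary: m)
  case (Suc n)
  have inj: "inj_on (\<lambda>(p, s). insert_max p s) (Sigma (avoiding_perms m) sites)"
    by (rule inj_onI, clarify) (meson inj_insert_max avoiding_perms_props(4) sites_le)
  have "(\<Sum>p\<in>avoiding_perms m. descendants (Suc n) p) =
      (\<Sum>(p, s)\<in>Sigma (avoiding_perms m) sites. descendants n (insert_max p s))"
    by (simp add: sum.Sigma)
  also have "\<dots> = (\<Sum>q\<in>avoiding_perms (Suc m). descendants n q)"
    unfolding avoiding_perms_Suc by (subst sum.reindex[OF inj]) (simp add: case_prod_unfold)
  finally show ?case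
    using Suc.IH[of "Suc m"] by simp
qed simp

lemma card_avoiding_perms: "card (avoiding_perms n) = descendants n []"
proof -
  have "avoiding_perms 0 = {[]}"
    by (auto simp: avoiding_perms_def avoids_def ascent_def pattern_312_def permutations_of_set_def)
  then show ?thesis
    using sum_descendants[of n 0] by simp
qed

section \<open>Sites after an insertion as sets, their order and ranks\<close>

lemma sites_insert_max_eq:
  assumes "bounded_list p" "s \<in> sites p"
  shows "sites (insert_max p s) = {t \<in> sites p. t \<le> s \<and> t \<in> pre_sites p} \<union>
      Suc ` {t \<in> sites p. s \<le> t \<and> s \<in> pre_sites p \<and> t \<in> suf_sites p}"
    "pre_sites (insert_max p s) = {t \<in> pre_sites p. t \<le> s} \<union> Suc ` {t \<in> pre_sites p. s = 0}"
    "suf_sites (insert_max p s) = {s} \<inter> suf_sites p \<union> Suc ` {t \<in> suf_sites p. s \<le> t}"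
proof -
  have s: "s \<le> length p"
    using assms(2) by (rule sites_le)
  have cases: "x \<le> s \<or> (\<exists>t\<ge>s. x = Suc t)" for x
    by (cases x) auto
  show "sites (insert_max p s) = {t \<in> sites p. t \<le> s \<and> t \<in> pre_sites p} \<union>
      Suc ` {t \<in> sites p. s \<le> t \<and> s \<in> pre_sites p \<and> t \<in> suf_sites p}"
  proof (rule set_eqI)
    fix x
    show "x \<in> sites (insert_max p s) \<longleftrightarrow> x \<in> {t \<in> sites p. t \<le> s \<and> t \<in> pre_sites p} \<union>
      Suc ` {t \<in> sites p. s \<le> t \<and> s \<in> pre_sites p \<and> t \<in> suf_sites p}"
      using cases[of x] sites_insert_max[OF assms(1) s] by auto
  qed
  show "pre_sites (insert_max p s) = {t \<in> pre_sites p. t \<le> s} \<union> Suc ` {t \<in> pre_sites p. s = 0}"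
  proof (rule set_eqI)
    fix x
    show "x \<in> pre_sites (insert_max p s) \<longleftrightarrow>
        x \<in> {t \<in> pre_sites p. t \<le> s} \<union> Suc ` {t \<in> pre_sites p. s = 0}"
      using cases[of x] pre_sites_insert_max[OF assms(1) s] by auto
  qed
  show "suf_sites (insert_max p s) = {s} \<inter> suf_sites p \<union> Suc ` {t \<in> suf_sites p. s \<le> t}"
  proof (rule set_eqI)
    fix x
    show "x \<in> suf_sites (insert_max p s) \<longleftrightarrow>
        x \<in> {s} \<inter> suf_sites p \<union> Suc ` {t \<in> suf_sites p. s \<le> t}"
      using cases[of x] suf_sites_insert_max[OF assms(1) s] by auto
  qed
qed

text \<open>With \<open>suf_sites_mono\<close> this orders the sites: decreasing prefixes to the
  left, decreasing suffixes to the right. So counting the sites of each kind describes their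
  arrangement.\<close>

lemma pre_sites_mono: "t \<in> pre_sites p \<Longrightarrow> s \<le> t \<Longrightarrow> s \<in> pre_sites p"
  unfolding pre_sites_def by (auto intro: le_trans)

lemma suf_sites_mono: "s \<in> suf_sites p \<Longrightarrow> s \<le> t \<Longrightarrow> t \<in> sites p \<Longrightarrow> t \<in> suf_sites p"
  using sites_le unfolding suf_sites_def by (auto intro: less_le_trans)

lemma zero_pre_sites: "0 \<in> pre_sites p"
  by (simp add: pre_sites_def)

lemma zero_sites: "0 \<in> sites p"
  by (simp add: sites_def)

definition rank :: "nat set \<Rightarrow> nat \<Rightarrow> nat" where
  "rank S s = card {t \<in> S. t \<le> s}"

text \<open>A new largest element leaves the earlier ranks alone and gets the next one. This turns
  sums over sites into the sums over labels of the succession rule.\<close>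

lemma sum_rank:
  fixes f :: "nat \<Rightarrow> 'a::comm_monoid_add"
  assumes "finite S"
  shows "(\<Sum>s\<in>S. f (rank S s)) = (\<Sum>i = 1..card S. f i)"
  using assms
proof (induction S rule: finite_linorder_max_induct)
  case (insert b A)
  have "rank (insert b A) s = rank A s" if "s \<in> A" for s
    unfolding rank_def using insert.hyps(2) that
    by (intro arg_cong[of _ _ card]) (auto dest: leD)
  moreover have "{t. (t = b \<or> t \<in> A) \<and> t \<le> b} = insert b A"
    using insert.hyps(2) by auto
  then have "rank (insert b A) b = Suc (card A)"
    using insert.hyps by (auto simp: rank_def)
  ultimately show ?case
    using insert by (auto simp: add.commute)
qed simp

lemma rank_Min:
  assumes "finite S" "s \<in> S" "\<And>t. t \<in> S \<Longrightarrow> s \<le> t"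
  shows "rank S s = 1"
proof -
  have "{t \<in> S. t \<le> s} = {s}"
    using assms by (auto intro: le_antisym)
  then show ?thesis by (simp add: rank_def)
qed

section \<open>The four families of states and the succession rule\<close>

text \<open>
  \<open>decr\<close>: decreasing permutations.  \<open>sep\<close>: from left to right, \<open>a\<close> sites with decreasing prefix only, one
  with both, \<open>r\<close> with decreasing suffix only.  \<open>gap\<close>: the same without the middle site.  \<open>pre\<close>: decreasing
  prefix only.
\<close>

definition decr_state :: "nat \<Rightarrow> nat list \<Rightarrow> bool" where
  "decr_state m p \<longleftrightarrow> bounded_list p \<and>
     sites p = {0..m} \<and> pre_sites p = {0..m} \<and> suf_sites p = {0..m}"

definition sep_state :: "nat \<Rightarrow> nat \<Rightarrow> nat list \<Rightarrow> bool" where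
  "sep_state a r p \<longleftrightarrow> bounded_list p \<and> sites p \<subseteq> pre_sites p \<union> suf_sites p \<and> 0 \<notin> suf_sites p \<and>
     is_singleton (sites p \<inter> pre_sites p \<inter> suf_sites p) \<and>
     card (sites p - suf_sites p) = a \<and> card (sites p - pre_sites p) = r"

definition gap_state :: "nat \<Rightarrow> nat \<Rightarrow> nat list \<Rightarrow> bool" where
  "gap_state a d p \<longleftrightarrow> bounded_list p \<and> sites p \<subseteq> pre_sites p \<union> suf_sites p \<and>
     sites p \<inter> pre_sites p \<inter> suf_sites p = {} \<and>
     card (sites p \<inter> pre_sites p) = a \<and> card (sites p \<inter> suf_sites p) = d"

definition pre_state :: "nat \<Rightarrow> nat list \<Rightarrow> bool" where
  "pre_state a p \<longleftrightarrow> bounded_list p \<and> sites p \<subseteq> pre_sites p \<and> sites p \<inter> suf_sites p = {} \<and>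
     card (sites p) = a"

text \<open>No site has a decreasing suffix, so every site beyond the maximum is lost.\<close>

lemma pre_state_insert_max:
  assumes "pre_state a p" "s \<in> sites p"
  shows "pre_state (rank (sites p) s) (insert_max p s)"
proof -
  have p: "bounded_list p" "sites p \<subseteq> pre_sites p" "sites p \<inter> suf_sites p = {}"
    using assms(1) by (auto simp: pre_state_def)
  have "sites (insert_max p s) = {t \<in> sites p. t \<le> s}"
    unfolding sites_insert_max_eq[OF p(1) assms(2)] using p by auto
  then show ?thesis
    using p assms(2) unfolding pre_state_def rank_def sites_insert_max_eq(2,3)[OF p(1) assms(2)]
    by (auto simp: bounded_insert_max)
qed

text \<open>At a left site, the left sites up to it and all right sites survive. At a right site,
  whose prefix does not decrease, nothing beyond the maximum survives, and exactly the left sites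
  remain.\<close>

lemma gap_state_insert_max:
  assumes "gap_state a d p" "s \<in> sites p"
  shows "s \<in> pre_sites p \<Longrightarrow> gap_state (rank (sites p \<inter> pre_sites p) s) d (insert_max p s)"
    "s \<in> suf_sites p \<Longrightarrow> pre_state a (insert_max p s)"
proof -
  have p: "bounded_list p" "sites p \<subseteq> pre_sites p \<union> suf_sites p"
    "sites p \<inter> pre_sites p \<inter> suf_sites p = {}" "card (sites p \<inter> pre_sites p) = a"
    "card (sites p \<inter> suf_sites p) = d"
    using assms(1) by (auto simp: gap_state_def)
  note eqs = sites_insert_max_eq[OF p(1) assms(2)]
  let ?q = "insert_max p s"
  have less: "t < u" if "t \<in> sites p" "t \<in> pre_sites p" "u \<in> sites p" "u \<in> suf_sites p" for t u
    using that p(3) pre_sites_mono[of t p u] by (cases "t < u") auto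
  {
    assume s: "s \<in> pre_sites p"
    have pre: "sites ?q \<inter> pre_sites ?q = {t \<in> sites p \<inter> pre_sites p. t \<le> s}"
      unfolding eqs using s p(3) by auto
    have suf: "sites ?q \<inter> suf_sites ?q = Suc ` (sites p \<inter> suf_sites p)"
      unfolding eqs using s p(3) less[of s] assms(2) by (auto intro: less_imp_le)
    have "sites ?q \<inter> pre_sites ?q \<inter> suf_sites ?q =
        (sites ?q \<inter> pre_sites ?q) \<inter> (sites ?q \<inter> suf_sites ?q)"
      by blast
    also have "\<dots> = {}"
      unfolding pre suf using less[of _ s] less s assms(2) by fastforce
    finally have "sites ?q \<inter> pre_sites ?q \<inter> suf_sites ?q = {}" .
    moreover have "sites ?q \<subseteq> pre_sites ?q \<union> suf_sites ?q"
      unfolding eqs by auto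
    ultimately show "gap_state (rank (sites p \<inter> pre_sites p) s) d ?q"
      unfolding gap_state_def rank_def pre suf using p(1,5)
      by (simp add: bounded_insert_max card_image)
  next
    assume s: "s \<in> suf_sites p"
    then have "sites ?q = sites p \<inter> pre_sites p"
      unfolding eqs using s p(3) less[of _ s] assms(2) by (auto intro: less_imp_le)
    moreover have "sites p \<inter> pre_sites p \<subseteq> pre_sites ?q"
      unfolding eqs using less[of _ s] assms(2) s by (auto intro: less_imp_le)
    moreover have "sites p \<inter> pre_sites p \<inter> suf_sites ?q = {}"
      unfolding eqs using less[of _ s] assms(2) s p(3) by fastforce
    ultimately show "pre_state a ?q"
      unfolding pre_state_def using p by (auto simp: bounded_insert_max)
  }
qed

lemma sep_state_insert_max:
  assumes "sep_state a r p" "s \<in> sites p"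
  shows "s = 0 \<Longrightarrow> sep_state 1 r (insert_max p s)"
    "s \<noteq> 0 \<Longrightarrow> s \<notin> suf_sites p \<Longrightarrow> gap_state (rank (sites p - suf_sites p) s) (Suc r) (insert_max p s)"
    "s \<in> pre_sites p \<Longrightarrow> s \<in> suf_sites p \<Longrightarrow> sep_state a (Suc r) (insert_max p s)"
    "s \<notin> pre_sites p \<Longrightarrow> pre_state (Suc a) (insert_max p s)"
proof -
  have p: "bounded_list p" "sites p \<subseteq> pre_sites p \<union> suf_sites p" "0 \<notin> suf_sites p"
    "card (sites p - suf_sites p) = a" "card (sites p - pre_sites p) = r"
    using assms(1) by (auto simp: sep_state_def)
  obtain c where c: "sites p \<inter> pre_sites p \<inter> suf_sites p = {c}"
    using assms(1) by (auto simp: sep_state_def is_singleton_def)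
  then have c_in: "c \<in> sites p" "c \<in> pre_sites p" "c \<in> suf_sites p"
    by auto
  have c_unique: "t = c" if "t \<in> sites p" "t \<in> pre_sites p" "t \<in> suf_sites p" for t
    using c that by auto
  note eqs = sites_insert_max_eq[OF p(1) assms(2)]
  let ?q = "insert_max p s"
  have lt_suf: "t < u" if "t \<in> sites p" "t \<notin> suf_sites p" "u \<in> suf_sites p" for t u
    using that suf_sites_mono[of u p t] by (cases "t < u") auto
  have lt_pre: "t < u" if "t \<in> pre_sites p" "u \<notin> pre_sites p" for t u
    using that pre_sites_mono[of t p u] by (cases "t < u") auto
  have ge_c: "c \<le> t" if "t \<in> sites p" "t \<in> suf_sites p" for t
    using that c_unique[of t] lt_pre[of c t] c_in by (cases "t \<in> pre_sites p") auto
  have pre_if: "t \<in> pre_sites p" if "t \<in> sites p" "t \<notin> suf_sites p" for t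
    using that p(2) by auto
  have suf_eq: "sites p \<inter> suf_sites p = insert c (sites p - pre_sites p)"
    using p(2) c by auto
  then have card_suf: "card (sites p \<inter> suf_sites p) = Suc r"
    using p(5) c_in by simp
  have q: "bounded_list ?q" "sites ?q \<subseteq> pre_sites ?q \<union> suf_sites ?q"
    using p(1) by (auto simp: bounded_insert_max eqs)
  {
    \<comment> \<open>With the maximum in front all prefixes stay decreasing, but of the left sites
      only 0 survives, as the others lack a decreasing suffix.\<close>
    assume s: "s = 0"
    have sites_q: "sites ?q = insert 0 (Suc ` (sites p \<inter> suf_sites p))"
      unfolding eqs using s zero_sites zero_pre_sites by auto
    have pre_q: "pre_sites ?q = insert 0 (Suc ` pre_sites p)"
      unfolding eqs using s zero_pre_sites by auto
    have suf_q: "suf_sites ?q = Suc ` suf_sites p"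
      unfolding eqs using s p(3) by auto
    have "sites ?q \<inter> pre_sites ?q \<inter> suf_sites ?q = {Suc c}"
    proof -
      have "sites ?q \<inter> pre_sites ?q \<inter> suf_sites ?q = Suc ` (sites p \<inter> pre_sites p \<inter> suf_sites p)"
        unfolding sites_q pre_q suf_q by auto
      then show ?thesis
        unfolding c by simp
    qed
    moreover have "sites ?q - suf_sites ?q = {0}"
      unfolding sites_q suf_q by auto
    moreover have "sites ?q - pre_sites ?q = Suc ` (sites p - pre_sites p)"
      unfolding sites_q pre_q using p(2) by auto
    moreover have "0 \<notin> suf_sites ?q"
      unfolding suf_q by auto
    ultimately show "sep_state 1 r ?q"
      unfolding sep_state_def using q p(5) by (simp add: card_image)
  next
    \<comment> \<open>The maximum now precedes \<open>c\<close> without being first, so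
      \<open>c\<close> loses its decreasing prefix and joins the right sites: hence
      \<open>Suc r\<close>.\<close>
    assume s: "s \<noteq> 0" "s \<notin> suf_sites p"
    have le: "s \<le> t" "t \<noteq> s" if "t \<in> suf_sites p" for t
      using lt_suf[OF assms(2) s(2) that] by simp_all
    have "{t \<in> sites p. t \<le> s \<and> t \<in> pre_sites p} = {t \<in> sites p - suf_sites p. t \<le> s}"
    proof (rule set_eqI)
      fix t
      show "t \<in> {t \<in> sites p. t \<le> s \<and> t \<in> pre_sites p} \<longleftrightarrow> t \<in> {t \<in> sites p - suf_sites p. t \<le> s}"
        using pre_if[of t] le[of t] by auto
    qed
    moreover have "{t \<in> sites p. s \<le> t \<and> s \<in> pre_sites p \<and> t \<in> suf_sites p} = sites p \<inter> suf_sites p"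
      using le pre_if[OF assms(2) s(2)] by auto
    ultimately have sites_q: "sites ?q = {t \<in> sites p - suf_sites p. t \<le> s} \<union> Suc ` (sites p \<inter> suf_sites p)"
      unfolding eqs by simp
    have Suc_suf: "Suc t \<in> suf_sites ?q" "Suc t \<notin> pre_sites ?q" if "t \<in> suf_sites p" for t
      unfolding eqs using s le[OF that] that by auto
    have lower: "t \<in> pre_sites ?q" "t \<notin> suf_sites ?q"
      if "t \<in> sites p" "t \<notin> suf_sites p" "t \<le> s" for t
      unfolding eqs using that pre_if[of t] s le by fastforce+
    have pre_q: "sites ?q \<inter> pre_sites ?q = {t \<in> sites p - suf_sites p. t \<le> s}"
      unfolding sites_q using lower Suc_suf by auto
    have suf_q: "sites ?q \<inter> suf_sites ?q = Suc ` (sites p \<inter> suf_sites p)"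
      unfolding sites_q using lower Suc_suf by auto
    have "sites ?q \<inter> pre_sites ?q \<inter> suf_sites ?q =
        (sites ?q \<inter> pre_sites ?q) \<inter> (sites ?q \<inter> suf_sites ?q)"
      by blast
    also have "\<dots> = {}"
      unfolding pre_q suf_q using le by fastforce
    finally have "sites ?q \<inter> pre_sites ?q \<inter> suf_sites ?q = {}" .
    then show "gap_state (rank (sites p - suf_sites p) s) (Suc r) ?q"
      unfolding gap_state_def rank_def pre_q suf_q using q card_suf
      by (simp add: card_image)
  next
    \<comment> \<open>Site \<open>c\<close> is doubled: the copy before the maximum keeps both
      properties, the copy after it becomes a right site.\<close>
    assume "s \<in> pre_sites p" "s \<in> suf_sites p"
    then have s: "s = c"
      using c_unique assms(2) by simp
    \<comment> \<open>Excludes a maximum in front, after which later prefixes would stay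
      decreasing.\<close>
    have c0: "c \<noteq> 0"
      using c_in p(3) by metis
    have "{t \<in> sites p. t \<le> c \<and> t \<in> pre_sites p} = insert c (sites p - suf_sites p)"
    proof (rule set_eqI)
      fix t
      show "t \<in> {t \<in> sites p. t \<le> c \<and> t \<in> pre_sites p} \<longleftrightarrow> t \<in> insert c (sites p - suf_sites p)"
        using c_unique[of t] lt_suf[of t c] pre_if[of t] c_in by auto
    qed
    moreover have "{t \<in> sites p. c \<le> t \<and> c \<in> pre_sites p \<and> t \<in> suf_sites p} = sites p \<inter> suf_sites p"
      using ge_c c_in by auto
    ultimately have sites_q: "sites ?q = insert c (sites p - suf_sites p) \<union> Suc ` (sites p \<inter> suf_sites p)"
      unfolding eqs unfolding s by simp
    have pre_q: "pre_sites ?q = {t \<in> pre_sites p. t \<le> c}"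
      unfolding eqs unfolding s using c0 by auto
    have suf_q: "suf_sites ?q = insert c (Suc ` {t \<in> suf_sites p. c \<le> t})"
      unfolding eqs unfolding s using c_in by auto
    have lt_c: "t < c" if "t \<in> sites p" "t \<notin> suf_sites p" for t
      using lt_suf that c_in by blast
    have Suc_suf: "Suc t \<in> suf_sites ?q" "Suc t \<notin> pre_sites ?q" if "t \<in> sites p" "t \<in> suf_sites p" for t
      unfolding suf_q pre_q using that ge_c[of t] by auto
    have lower: "t \<in> pre_sites ?q" "t \<notin> suf_sites ?q" if "t \<in> sites p" "t \<notin> suf_sites p" for t
      unfolding suf_q pre_q using that lt_c[of t] pre_if[of t] by auto
    have "c \<in> pre_sites ?q" "c \<in> suf_sites ?q"
      unfolding suf_q pre_q using c_in by auto
    note colours = Suc_suf lower this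
    have "sites ?q \<inter> pre_sites ?q \<inter> suf_sites ?q = {c}"
      unfolding sites_q using colours by auto
    moreover have "sites ?q - suf_sites ?q = sites p - suf_sites p"
      unfolding sites_q using colours by auto
    moreover have "sites ?q - pre_sites ?q = Suc ` (sites p \<inter> suf_sites p)"
      unfolding sites_q using colours by auto
    moreover have "0 \<notin> suf_sites ?q"
      unfolding suf_q using c0 by auto
    ultimately show "sep_state a (Suc r) ?q"
      unfolding sep_state_def using q p(4) card_suf by (simp add: card_image)
  next
    \<comment> \<open>Nothing beyond the maximum survives, and the suffix after \<open>c\<close> now
      ascends to the maximum, so \<open>c\<close> joins the left sites.\<close>
    assume s: "s \<notin> pre_sites p"
    have lt_s: "t < s" if "t \<in> pre_sites p" for t
      using lt_pre s that by blast
    have "{t \<in> sites p. t \<le> s \<and> t \<in> pre_sites p} = insert c (sites p - suf_sites p)"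
    proof (rule set_eqI)
      fix t
      show "t \<in> {t \<in> sites p. t \<le> s \<and> t \<in> pre_sites p} \<longleftrightarrow> t \<in> insert c (sites p - suf_sites p)"
        using c_unique[of t] lt_s[of t] pre_if[of t] c_in by auto
    qed
    then have sites_q: "sites ?q = insert c (sites p - suf_sites p)"
      unfolding eqs using s by simp
    have "t \<in> pre_sites ?q" "t \<notin> suf_sites ?q" if "t \<in> pre_sites p" "t \<in> sites p" for t
      unfolding eqs using lt_s[OF that(1)] that(1) by auto
    then have "sites ?q \<subseteq> pre_sites ?q" "sites ?q \<inter> suf_sites ?q = {}"
      unfolding sites_q using c_in pre_if by auto
    then show "pre_state (Suc a) ?q"
      unfolding pre_state_def using q(1) p(4) c_in by (simp add: sites_q)
  }
qed

text \<open>All sites stay admissible. If the maximum has \<open>s > 0\<close> letters before it,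
  only site \<open>s\<close> keeps both properties; the \<open>s\<close> earlier sites keep the
  prefix, the \<open>Suc m - s\<close> later ones the suffix.\<close>

lemma decr_state_insert_max:
  assumes "decr_state m p" "s \<le> m"
  shows "s = 0 \<Longrightarrow> decr_state (Suc m) (insert_max p s)"
    "s \<noteq> 0 \<Longrightarrow> sep_state s (Suc m - s) (insert_max p s)"
proof -
  have p: "bounded_list p" "sites p = {0..m}" "pre_sites p = {0..m}" "suf_sites p = {0..m}"
    using assms(1) by (auto simp: decr_state_def)
  have s: "s \<in> sites p"
    using assms(2) p(2) by simp
  note eqs = sites_insert_max_eq[OF p(1) s]
  let ?q = "insert_max p s"
  have sites_q: "sites ?q = {0..Suc m}"
    unfolding eqs p image_Suc_atLeastAtMost
  proof (rule set_eqI)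
    fix x
    show "x \<in> {t \<in> {0..m}. t \<le> s \<and> t \<in> {0..m}} \<union> Suc ` {t \<in> {0..m}. s \<le> t \<and> s \<in> {0..m} \<and> t \<in> {0..m}}
        \<longleftrightarrow> x \<in> {0..Suc m}"
      using assms(2) by (cases x) auto
  qed
  have suf_q: "suf_sites ?q = {s..Suc m}"
    unfolding eqs p
  proof (rule set_eqI)
    fix x
    show "x \<in> {s} \<inter> {0..m} \<union> Suc ` {t \<in> {0..m}. s \<le> t} \<longleftrightarrow> x \<in> {s..Suc m}"
      using assms(2) by (cases x) auto
  qed
  {
    assume s0: "s = 0"
    have "pre_sites ?q = {0..Suc m}"
      unfolding eqs(2) p unfolding s0
    proof (rule set_eqI)
      fix x
      show "x \<in> {t \<in> {0..m}. t \<le> 0} \<union> Suc ` {t \<in> {0..m}. (0::nat) = 0} \<longleftrightarrow> x \<in> {0..Suc m}"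
        by (cases x) auto
    qed
    then show "decr_state (Suc m) ?q"
      using s0 p(1) sites_q suf_q by (simp add: decr_state_def bounded_insert_max)
  next
    assume s0: "s \<noteq> 0"
    have pre_q: "pre_sites ?q = {0..s}"
      unfolding eqs p using s0 assms(2) by auto
    have "{0..Suc m} \<inter> {0..s} \<inter> {s..Suc m} = {s}" "{0..Suc m} - {s..Suc m} = {0..<s}"
      "{0..Suc m} - {0..s} = {Suc s..Suc m}"
      using assms(2) by auto
    then show "sep_state s (Suc m - s) ?q"
      unfolding sep_state_def sites_q suf_q pre_q using p(1) s0 assms(2)
      by (auto simp: bounded_insert_max)
  }
qed

section \<open>Closed forms of the generating functions\<close>

locale two_poles =
  fixes x u w :: "'a::idom"
  assumes u: "u * (1 - x) = 1" and w: "w * (1 - 2 * x) = 1"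
begin

text \<open>
  Solving the succession rule from \<open>pre\<close> upwards gives these closed forms, with \<open>u = 1 / (1 - x)\<close> and
  \<open>w = 1 / (1 - 2 x)\<close>.  The functions for \<open>gap\<close> and \<open>sep\<close> are affine in their second parameter.
\<close>

definition pre_gf :: "nat \<Rightarrow> 'a" where
  "pre_gf a = u ^ a"

definition gap_slope :: "nat \<Rightarrow> 'a" where
  "gap_slope a = x * u ^ Suc a * (1 - x + of_nat a * x)"

definition gap_gf :: "nat \<Rightarrow> nat \<Rightarrow> 'a" where
  "gap_gf a d = u ^ a + of_nat d * gap_slope a"

text \<open>\<open>\<gamma> + of_nat r * \<kappa>\<close> is
  \<open>x * (sep_gf 1 r - gap_gf 1 (Suc r))\<close>, since in the rule for \<open>sep\<close> the
  child \<open>sep (1, r)\<close> stands where \<open>gap (1, r + 1)\<close> would be;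
  \<open>\<alpha>\<^sub>1\<close> is \<open>sep_const 1\<close>.\<close>

definition "\<kappa> = 2 * x ^ 3 * u ^ 2 * w"
definition "\<alpha>\<^sub>1 = w * (1 + x ^ 2 * u ^ 2 * w)"
definition "\<gamma> = x * \<alpha>\<^sub>1 - x * u - x ^ 2 * u ^ 2"

definition sep_slope :: "nat \<Rightarrow> 'a" where
  "sep_slope a = u * (\<kappa> + x * u ^ Suc a * (1 + of_nat a * x))"

definition sep_const :: "nat \<Rightarrow> 'a" where
  "sep_const a = u * (\<gamma> + x * sep_slope a + u ^ a + of_nat a * x ^ 2 * u ^ Suc a)"

definition sep_gf :: "nat \<Rightarrow> nat \<Rightarrow> 'a" where
  "sep_gf a r = sep_const a + of_nat r * sep_slope a"

text \<open>
  The \<open>\<tau>\<close> and \<open>\<sigma>\<close> are the coefficients of the convolution of the \<open>sep\<close> functions in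
  \<open>sum_sep_gf\<close>, and \<open>c\<close>, \<open>e\<close> those of \<open>decr_gf\<close>, obtained by comparing coefficients of
  \<open>1\<close>, \<open>m\<close>, \<open>m choose 2\<close>, \<open>u ^ m\<close> and \<open>m u ^ m\<close>.
\<close>

definition "\<tau>\<^sub>1 = u * (x * \<kappa> - x ^ 2 * u + x * \<gamma> + x ^ 2 * u * \<kappa>)"
definition "\<tau>\<^sub>2 = u * x * \<kappa>"
definition "\<sigma>\<^sub>0 = u * (x * u - x + x ^ 3 * u ^ 2)"
definition "\<sigma>\<^sub>1 = u * (x * u + x ^ 3 * u ^ 2 + x ^ 2 * u)"
definition "c\<^sub>2 = u * \<tau>\<^sub>2"
definition "c\<^sub>1 = u * (\<tau>\<^sub>1 + x * c\<^sub>2)"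
definition "c\<^sub>0 = u * (1 - \<sigma>\<^sub>0 + x * c\<^sub>1)"
definition "e\<^sub>1 = (1 - x) * w * \<sigma>\<^sub>1"
definition "e\<^sub>0 = (1 - x) * w * (\<sigma>\<^sub>0 + x * u * e\<^sub>1)"

definition decr_gf :: "nat \<Rightarrow> 'a" where
  "decr_gf m = c\<^sub>0 + of_nat m * c\<^sub>1 + of_nat (m choose 2) * c\<^sub>2 + (e\<^sub>0 + of_nat m * e\<^sub>1) * u ^ m"

lemma u_rec: "u = 1 + x * u"
  using u by (simp add: algebra_simps)

lemma w_rec: "w = 1 + 2 * x * w"
  using w by (simp add: algebra_simps)

text \<open>\<open>u * a\<close> solves \<open>f = a + x * f\<close>, so constants defined as
  \<open>u * a\<close> satisfy the recurrences they were solved from.\<close>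

lemma mult_u_rec: "u * a = a + x * (u * a)"
  by (subst u_rec) (simp add: algebra_simps)

text \<open>For use at \<open>a = 1\<close>: both \<open>sep (1, r)\<close> and
  \<open>sep (1, r + 1)\<close> are children of \<open>sep (1, r)\<close>, which turns the pole
  \<open>1 - x\<close> into \<open>1 - 2 * x\<close>.\<close>

lemma u_w: "u * (1 + x * w) = w"
proof -
  have "1 + x * w = (1 - x) * w"
    using w by (simp add: algebra_simps)
  then have "u * (1 + x * w) = u * (1 - x) * w"
    by simp
  then show ?thesis
    using u by simp
qed

text \<open>Telescopes, since \<open>x * u ^ Suc i = u ^ Suc i - u ^ i\<close>.\<close>

lemma sum_power_u: "x * (\<Sum>i = 1..a. u ^ i) = u ^ a - 1"
proof (induction a)
  case (Suc a)
  have "u ^ Suc a = u ^ a + x * u ^ Suc a"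
    using mult_u_rec[of "u ^ a"] by simp
  then show ?case
    using Suc by (simp add: distrib_left)
qed simp

lemma gap_slope_eq: "gap_slope a = x * u ^ a + of_nat a * x ^ 2 * u ^ Suc a"
proof -
  have "gap_slope a = x * u ^ a * (u * (1 - x)) + of_nat a * x ^ 2 * u ^ Suc a"
    by (simp add: gap_slope_def algebra_simps power2_eq_square)
  then show ?thesis
    by (simp add: u)
qed

lemma sum_gap_slope: "x * (\<Sum>i = 1..a. gap_slope i) = gap_slope a - x * u ^ a"
proof (induction a)
  case (Suc a)
  have pow: "u ^ Suc a = u ^ a + x * u ^ Suc a" "u ^ Suc (Suc a) = u ^ Suc a + x * u ^ Suc (Suc a)"
    using mult_u_rec[of "u ^ a"] mult_u_rec[of "u ^ Suc a"] by simp_all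
  have "x * gap_slope (Suc a) = gap_slope (Suc a) - gap_slope a - x * u ^ Suc a + x * u ^ a"
  proof -
    \<comment> \<open>Powers with symbolic exponent become variables linked by
      \<open>y' = y + x * y'\<close>, leaving a polynomial identity. The facts named
      \<open>ring\<close> below also treat powers as variables.\<close>
    have "x * (x * y' + (1 + n) * x ^ 2 * y'') =
        x * y' + (1 + n) * x ^ 2 * y'' - (x * y + n * x ^ 2 * y') - x * y' + x * y"
      if "y' = y + x * y'" "y'' = y' + x * y''" for y y' y'' n
      using that by algebra
    from this[OF pow] show ?thesis
      unfolding gap_slope_eq of_nat_Suc .
  qed
  moreover have "x * (\<Sum>i = 1..Suc a. gap_slope i) = x * (\<Sum>i = 1..a. gap_slope i) + x * gap_slope (Suc a)"
    by (simp add: distrib_left)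
  ultimately show ?case
    unfolding Suc.IH by simp
qed (simp add: gap_slope_eq)

text \<open>The 1 counts the state itself, and each child in the succession rule contributes
  \<open>x\<close> times its function; so too in the later \<open>_gf_rec\<close> lemmas.\<close>

lemma pre_gf_rec: "pre_gf a = 1 + x * (\<Sum>i = 1..a. pre_gf i)"
  using sum_power_u[of a] by (simp add: pre_gf_def)

lemma sum_gap_gf: "x * (\<Sum>i = 1..a. gap_gf i d) = u ^ a - 1 + of_nat d * (gap_slope a - x * u ^ a)"
proof -
  have "x * (\<Sum>i = 1..a. gap_gf i d) =
      x * (\<Sum>i = 1..a. u ^ i) + of_nat d * (x * (\<Sum>i = 1..a. gap_slope i))"
    unfolding gap_gf_def sum.distrib sum_distrib_left[symmetric] by (simp add: algebra_simps)
  then show ?thesis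
    unfolding sum_power_u sum_gap_slope .
qed

lemma gap_gf_rec: "gap_gf a d = 1 + x * ((\<Sum>i = 1..a. gap_gf i d) + of_nat d * pre_gf a)"
  unfolding distrib_left[of x] sum_gap_gf by (simp add: gap_gf_def pre_gf_def algebra_simps)

lemma \<kappa>_eq: "\<kappa> = x * (x * u ^ 2 * w) - x ^ 2 * u ^ 2"
proof -
  have "x * (x * u ^ 2 * w) = x ^ 2 * u ^ 2 * (1 + 2 * x * w)"
    by (subst w_rec) (simp add: power2_eq_square algebra_simps)
  then show ?thesis
    by (simp add: \<kappa>_def algebra_simps power2_eq_square power3_eq_cube)
qed

text \<open>Through \<kappa> and \<gamma> the closed forms presuppose their own values at
  \<open>a = 1\<close>; this closes the circle.\<close>

lemma sep_gf_1: "sep_const 1 = \<alpha>\<^sub>1" "sep_slope 1 = x * u ^ 2 * w"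
proof -
  have "sep_slope 1 = x * u ^ 2 * (u * (1 + x * w))"
    unfolding sep_slope_def \<kappa>_eq by (simp add: algebra_simps power2_eq_square)
  then show *: "sep_slope 1 = x * u ^ 2 * w"
    unfolding u_w .
  have "sep_const 1 = u * (x * \<alpha>\<^sub>1 + x * (x * u ^ 2 * w) + u * (1 - x))"
    unfolding sep_const_def * \<gamma>_def by (simp add: algebra_simps power2_eq_square)
  also have "\<dots> = u * (1 + x * w) * (1 + x ^ 2 * u ^ 2 * w)"
    unfolding u \<alpha>\<^sub>1_def by (simp add: algebra_simps power2_eq_square)
  finally show "sep_const 1 = \<alpha>\<^sub>1"
    unfolding u_w \<alpha>\<^sub>1_def .
qed

lemma sep_slope_rec: "sep_slope a = x * sep_slope a + \<kappa> + x * u ^ Suc a * (1 + of_nat a * x)"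
  unfolding sep_slope_def by (rule trans[OF mult_u_rec]) (simp only: add_ac)

lemma sep_const_rec:
  "sep_const a = x * sep_const a + \<gamma> + x * sep_slope a + u ^ a + of_nat a * x ^ 2 * u ^ Suc a"
  unfolding sep_const_def by (rule trans[OF mult_u_rec]) (simp only: add_ac)

text \<open>Both sides are affine in \<open>r\<close>; comparing slopes and constant parts gives
  \<open>sep_slope_rec\<close> and \<open>sep_const_rec\<close>. The sum starts at 2, so
  \<open>gap_gf 1 (Suc r)\<close> is subtracted from \<open>sum_gap_gf\<close>.\<close>

lemma sep_gf_rec:
  assumes "a \<ge> 1"
  shows "sep_gf a r = 1 + x * (sep_gf 1 r + (\<Sum>i = 2..a. gap_gf i (Suc r)) +
    sep_gf a (Suc r) + of_nat r * pre_gf (Suc a))"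
proof -
  have "{1..a} = insert 1 {2..a}"
    using assms by auto
  then have "x * (\<Sum>i = 1..a. gap_gf i (Suc r)) = x * (gap_gf 1 (Suc r) + (\<Sum>i = 2..a. gap_gf i (Suc r)))"
    by simp
  then have sum: "x * (\<Sum>i = 2..a. gap_gf i (Suc r)) =
      u ^ a - 1 + of_nat (Suc r) * (gap_slope a - x * u ^ a) - x * gap_gf 1 (Suc r)"
    unfolding sum_gap_gf by (simp add: algebra_simps)
  have gap_1: "gap_gf 1 (Suc r) = u + of_nat (Suc r) * (x * u ^ 2)"
    by (simp add: gap_gf_def gap_slope_def power2_eq_square)
  have ring: "c + m * s = 1 + x * ((\<alpha>\<^sub>1 + m * s1) + S + (c + (1 + m) * s) + m * y')"
    if "x * S = y - 1 + (1 + m) * ((x * y + n * x ^ 2 * y') - x * y) - x * (u + (1 + m) * (x * u ^ 2))"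
      "s = x * s + \<kappa> + x * y' * (1 + n * x)" "c = x * c + \<gamma> + x * s + y + n * x ^ 2 * y'"
      "\<kappa> = x * s1 - x ^ 2 * u ^ 2" "\<gamma> = x * \<alpha>\<^sub>1 - x * u - x ^ 2 * u ^ 2" for c m s s1 S y y' n
    using that by algebra
  show ?thesis
    unfolding sep_gf_def sep_gf_1 pre_gf_def of_nat_Suc
    by (rule ring[OF _ sep_slope_rec sep_const_rec \<kappa>_eq \<gamma>_def])
      (use sum in \<open>simp only: gap_1 gap_slope_eq of_nat_Suc\<close>)
qed

lemma power_u_Suc: "u ^ Suc m = u ^ m + x * u ^ Suc m"
  using mult_u_rec[of "u ^ m"] by simp

lemma sum_sep_slope:
  "(\<Sum>s = 1..m. sep_slope s) =
     u * (of_nat m * \<kappa> + x * u * (u ^ m - 1) + x * u * (of_nat m * u ^ m))"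
proof (induction m)
  case (Suc m)
  have ring: "u * (n * \<kappa> + x * u * (y - 1) + x * u * (n * y)) + u * (\<kappa> + x * (u * y') * (1 + (1 + n) * x)) =
      u * ((1 + n) * \<kappa> + x * u * (y' - 1) + x * u * ((1 + n) * y'))" if "y' = y + x * y'" for n y y'
    using that by algebra
  have "(\<Sum>s = 1..Suc m. sep_slope s) = (\<Sum>s = 1..m. sep_slope s) + sep_slope (Suc m)"
    by simp
  also have "\<dots> = u * (of_nat (Suc m) * \<kappa> + x * u * (u ^ Suc m - 1) + x * u * (of_nat (Suc m) * u ^ Suc m))"
    unfolding Suc.IH sep_slope_def[of "Suc m"] power_Suc[of u "Suc m"] of_nat_Suc
    by (rule ring[OF power_u_Suc])
  finally show ?case .
qed simp

lemma sum_sep_gf: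
  "x * (\<Sum>s = 1..m. sep_gf s (Suc m - s)) =
     of_nat m * \<tau>\<^sub>1 + of_nat (m choose 2) * \<tau>\<^sub>2 + (\<sigma>\<^sub>0 + of_nat m * \<sigma>\<^sub>1) * u ^ m - \<sigma>\<^sub>0"
proof (induction m)
  case (Suc m)
  have ring: "n * \<tau>\<^sub>1 + b * \<tau>\<^sub>2 + (\<sigma>\<^sub>0 + n * \<sigma>\<^sub>1) * y - \<sigma>\<^sub>0 +
      x * (u * ((1 + n) * \<kappa> + x * u * (y' - 1) + x * u * ((1 + n) * y'))) +
      x * (u * (\<gamma> + x * (u * (\<kappa> + x * (u * y') * (1 + (1 + n) * x))) + y' + (1 + n) * x ^ 2 * (u * y'))) =
      (1 + n) * \<tau>\<^sub>1 + (n + b) * \<tau>\<^sub>2 + (\<sigma>\<^sub>0 + (1 + n) * \<sigma>\<^sub>1) * y' - \<sigma>\<^sub>0"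
    if "y' = y + x * y'" for n b y y'
    using that u_rec \<tau>\<^sub>1_def \<tau>\<^sub>2_def \<sigma>\<^sub>0_def \<sigma>\<^sub>1_def by algebra
  have choose: "Suc m choose 2 = m + (m choose 2)"
    by (simp add: numeral_2_eq_2)
  have "(\<Sum>s = 1..Suc m. sep_gf s (Suc (Suc m) - s)) =
      (\<Sum>s = 1..m. sep_gf s (Suc (Suc m) - s)) + sep_gf (Suc m) 1"
    by simp
  \<comment> \<open>Raising \<open>m\<close> raises the second parameter of each earlier summand by
    one, which by affinity adds one \<open>sep_slope\<close>.\<close>
  also have "(\<Sum>s = 1..m. sep_gf s (Suc (Suc m) - s)) =
      (\<Sum>s = 1..m. sep_gf s (Suc m - s) + sep_slope s)"
    by (intro sum.cong) (auto simp: sep_gf_def Suc_diff_le algebra_simps)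
  finally have "x * (\<Sum>s = 1..Suc m. sep_gf s (Suc (Suc m) - s)) =
      x * (\<Sum>s = 1..m. sep_gf s (Suc m - s)) + x * (\<Sum>s = 1..Suc m. sep_slope s) + x * sep_const (Suc m)"
    by (simp add: sum.distrib distrib_left sep_gf_def[of "Suc m" "Suc 0"])
  also have "\<dots> = of_nat (Suc m) * \<tau>\<^sub>1 + of_nat (Suc m choose 2) * \<tau>\<^sub>2 +
      (\<sigma>\<^sub>0 + of_nat (Suc m) * \<sigma>\<^sub>1) * u ^ Suc m - \<sigma>\<^sub>0"
    unfolding Suc.IH sum_sep_slope unfolding sep_const_def sep_slope_def power_Suc[of u "Suc m"] of_nat_Suc
      choose of_nat_add
    by (rule ring[OF power_u_Suc])
  finally show ?case .
qed (simp add: binomial_eq_0)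

text \<open>The child \<open>decr_gf (Suc m)\<close> has the larger label, so induction on
  \<open>m\<close> is of no help; the closed form is substituted and coefficients are
  compared.\<close>

lemma decr_gf_rec:
  "decr_gf m = 1 + x * (decr_gf (Suc m) + (\<Sum>s = 1..m. sep_gf s (Suc m - s)))"
proof -
  \<comment> \<open>\<open>(1 - x) * w\<close> inverts \<open>1 - x * u\<close>; the factor
    \<open>x * u\<close> stems from \<open>u ^ Suc m = u * u ^ m\<close>.\<close>
  have solve: "f = x * u * f + g" if "f = (1 - x) * w * g" for f g
    using that u w by algebra
  have e: "e\<^sub>1 = x * u * e\<^sub>1 + \<sigma>\<^sub>1" "e\<^sub>0 = x * u * e\<^sub>0 + (\<sigma>\<^sub>0 + x * u * e\<^sub>1)"
    by (rule solve, rule e\<^sub>1_def) (rule solve, rule e\<^sub>0_def)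
  have c: "c\<^sub>2 = \<tau>\<^sub>2 + x * c\<^sub>2" "c\<^sub>1 = \<tau>\<^sub>1 + x * c\<^sub>2 + x * c\<^sub>1" "c\<^sub>0 = 1 - \<sigma>\<^sub>0 + x * c\<^sub>1 + x * c\<^sub>0"
    unfolding c\<^sub>2_def c\<^sub>1_def c\<^sub>0_def by (rule mult_u_rec)+
  have choose: "Suc m choose 2 = m + (m choose 2)"
    by (simp add: numeral_2_eq_2)
  have ring: "c\<^sub>0 + n * c\<^sub>1 + b * c\<^sub>2 + (e\<^sub>0 + n * e\<^sub>1) * y =
      1 + x * ((c\<^sub>0 + (1 + n) * c\<^sub>1 + (n + b) * c\<^sub>2 + (e\<^sub>0 + (1 + n) * e\<^sub>1) * (u * y)) + S)"
    if "x * S = n * \<tau>\<^sub>1 + b * \<tau>\<^sub>2 + (\<sigma>\<^sub>0 + n * \<sigma>\<^sub>1) * y - \<sigma>\<^sub>0" for n b y S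
    using that e c by algebra
  show ?thesis
    unfolding decr_gf_def choose of_nat_Suc of_nat_add power_Suc
    by (rule ring[OF sum_sep_gf])
qed

text \<open>\<open>decr_gf 0\<close> is \<open>c\<^sub>0 + e\<^sub>0\<close>. Following the
  definitions, each constant is multiplied by powers of \<open>p\<close> and \<open>q\<close> that
  make it a polynomial.\<close>

lemma decr_gf_0:
  "decr_gf 0 * ((1 - x) ^ 6 * (1 - 2 * x) ^ 2) =
     1 - 9 * x + 35 * x ^ 2 - 75 * x ^ 3 + 98 * x ^ 4 - 78 * x ^ 5 + 36 * x ^ 6 - 12 * x ^ 7"
proof -
  define p where "p = 1 - x"
  define q where "q = 1 - 2 * x"
  have up: "u * p = 1" and wq: "w * q = 1"
    using u w by (simp_all add: p_def q_def)
  have \<kappa>: "p ^ 2 * q * \<kappa> = 2 * x ^ 3"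
    using up wq \<kappa>_def by algebra
  have "p ^ 2 * q ^ 2 * \<alpha>\<^sub>1 = p ^ 2 * q + x ^ 2"
    using up wq \<alpha>\<^sub>1_def by algebra
  then have \<gamma>: "p ^ 2 * q ^ 2 * \<gamma> = x * (p ^ 2 * q + x ^ 2) - x * p * q ^ 2 - x ^ 2 * q ^ 2"
    using up \<gamma>_def by algebra
  have c\<^sub>2: "p ^ 4 * q * c\<^sub>2 = 2 * x ^ 4"
    using up \<kappa> c\<^sub>2_def \<tau>\<^sub>2_def by algebra
  have "p ^ 4 * q ^ 2 * \<tau>\<^sub>1 = x * p * q * (2 * x ^ 3) - x ^ 2 * p ^ 2 * q ^ 2 +
      x * p * (p ^ 2 * q ^ 2 * \<gamma>) + x ^ 2 * q * (2 * x ^ 3)"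
    using up \<kappa> \<tau>\<^sub>1_def by algebra
  then have c\<^sub>1: "p ^ 5 * q ^ 2 * c\<^sub>1 = x * p * q * (2 * x ^ 3) - x ^ 2 * p ^ 2 * q ^ 2 +
      x * p * (p ^ 2 * q ^ 2 * \<gamma>) + x ^ 2 * q * (2 * x ^ 3) + x * q * (2 * x ^ 4)"
    using up c\<^sub>2 c\<^sub>1_def by algebra
  have \<sigma>\<^sub>0: "p ^ 3 * \<sigma>\<^sub>0 = x * p - x * p ^ 2 + x ^ 3"
    using up \<sigma>\<^sub>0_def by algebra
  have "p ^ 3 * \<sigma>\<^sub>1 = x * p + x ^ 3 + x ^ 2 * p"
    using up \<sigma>\<^sub>1_def by algebra
  then have e\<^sub>1: "p ^ 2 * q * e\<^sub>1 = x * p + x ^ 3 + x ^ 2 * p"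
    using wq e\<^sub>1_def p_def by algebra
  have e\<^sub>0: "p ^ 3 * q ^ 2 * e\<^sub>0 = p * q * (p ^ 3 * \<sigma>\<^sub>0) + x * p * (p ^ 2 * q * e\<^sub>1)"
    using wq up e\<^sub>0_def p_def by algebra
  have c\<^sub>0: "p ^ 6 * q ^ 2 * c\<^sub>0 = p ^ 5 * q ^ 2 - p ^ 2 * q ^ 2 * (p ^ 3 * \<sigma>\<^sub>0) + x * (p ^ 5 * q ^ 2 * c\<^sub>1)"
    using up c\<^sub>0_def by algebra
  have "decr_gf 0 * (p ^ 6 * q ^ 2) = p ^ 6 * q ^ 2 * c\<^sub>0 + p ^ 3 * (p ^ 3 * q ^ 2 * e\<^sub>0)"
    by (simp add: decr_gf_def binomial_eq_0 algebra_simps flip: power_add)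
  then show ?thesis
    unfolding c\<^sub>0 c\<^sub>1 e\<^sub>0 e\<^sub>1 \<sigma>\<^sub>0 \<gamma> unfolding p_def q_def by algebra
qed

end

section \<open>Numbers of descendants as coefficients\<close>

lemma fps_nth_rec:
  fixes f :: "'a::comm_ring_1 fps"
  assumes "f = 1 + fps_X * g"
  shows "fps_nth f 0 = 1" "fps_nth f (Suc n) = fps_nth g n"
  by (subst assms, simp)+

interpretation two_poles "fps_X :: rat fps" "inverse (1 - fps_X)" "inverse (1 - 2 * fps_X)"
  by unfold_locales (simp_all add: inverse_mult_eq_1)

text \<open>Coefficient \<open>Suc n\<close> is, by the recurrence, the sum of the coefficients
  \<open>n\<close> of the children, just as \<open>descendants\<close> recurses; induction on
  \<open>n\<close> thus identifies the two for all labels at once.\<close>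

lemma descendants_pre_state:
  "pre_state a p \<Longrightarrow> of_nat (descendants n p) = fps_nth (pre_gf a) n"
proof (induction n arbitrary: a p)
  case 0
  then show ?case by (simp add: fps_nth_rec[OF pre_gf_rec])
next
  case (Suc n)
  have card: "card (sites p) = a"
    using Suc.prems by (simp add: pre_state_def)
  have "of_nat (descendants (Suc n) p) = (\<Sum>s\<in>sites p. fps_nth (pre_gf (rank (sites p) s)) n)"
    by (simp add: Suc.IH[OF pre_state_insert_max[OF Suc.prems]])
  also have "\<dots> = (\<Sum>i = 1..a. fps_nth (pre_gf i) n)"
    using sum_rank[of "sites p" "\<lambda>i. fps_nth (pre_gf i) n"] card by simp
  finally show ?case
    by (simp add: fps_nth_rec[OF pre_gf_rec] fps_sum_nth)
qed

lemma descendants_gap_state: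
  "gap_state a d p \<Longrightarrow> of_nat (descendants n p) = fps_nth (gap_gf a d) n"
proof (induction n arbitrary: a d p)
  case 0
  then show ?case by (simp add: fps_nth_rec[OF gap_gf_rec])
next
  case (Suc n)
  let ?A = "sites p \<inter> pre_sites p" and ?D = "sites p \<inter> suf_sites p"
  have p: "sites p = ?A \<union> ?D" "?A \<inter> ?D = {}" "card ?A = a" "card ?D = d"
    using Suc.prems by (auto simp: gap_state_def)
  let ?f = "\<lambda>s. of_nat (descendants n (insert_max p s)) :: rat"
  have "(\<Sum>s\<in>sites p. ?f s) = (\<Sum>s\<in>?A. ?f s) + (\<Sum>s\<in>?D. ?f s)"
    using p(2) by (subst p(1), subst sum.union_disjoint) auto
  also have "(\<Sum>s\<in>?A. ?f s) = (\<Sum>s\<in>?A. fps_nth (gap_gf (rank ?A s) d) n)"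
    using gap_state_insert_max(1)[OF Suc.prems] by (intro sum.cong) (auto intro: Suc.IH)
  also have "\<dots> = (\<Sum>i = 1..a. fps_nth (gap_gf i d) n)"
    using sum_rank[of ?A "\<lambda>i. fps_nth (gap_gf i d) n"] p(3) by simp
  also have "(\<Sum>s\<in>?D. ?f s) = (\<Sum>s\<in>?D. fps_nth (pre_gf a) n)"
    using gap_state_insert_max(2)[OF Suc.prems] by (intro sum.cong) (auto intro: descendants_pre_state)
  finally show ?case
    using p(4) by (simp add: fps_nth_rec[OF gap_gf_rec] fps_sum_nth)
qed

lemma descendants_sep_state:
  "sep_state a r p \<Longrightarrow> of_nat (descendants n p) = fps_nth (sep_gf a r) n"
proof (induction n arbitrary: a r p)
  case (Suc n)
  let ?N = "sites p - suf_sites p" and ?R = "sites p - pre_sites p"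
  have p: "sites p \<subseteq> pre_sites p \<union> suf_sites p" "0 \<notin> suf_sites p" "card ?N = a" "card ?R = r"
    using Suc.prems by (auto simp: sep_state_def)
  obtain c where c: "sites p \<inter> pre_sites p \<inter> suf_sites p = {c}"
    using Suc.prems by (auto simp: sep_state_def is_singleton_def)
  then have c_in: "c \<in> sites p" "c \<in> pre_sites p" "c \<in> suf_sites p"
    by auto
  \<comment> \<open>Site 0 is always a left site, whence \<open>a \<ge> 1\<close>, as
    \<open>sep_gf_rec\<close> requires.\<close>
  have N: "finite ?N" "0 \<in> ?N"
    using p(2) zero_sites by auto
  then have a: "a \<ge> 1"
    using p(3) card_0_eq[of ?N] by (cases a) auto
  let ?f = "\<lambda>s. of_nat (descendants n (insert_max p s)) :: rat"
  have sites: "sites p = (?N \<union> ?R) \<union> {c}"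
    using p(1) c by blast
  have disj: "?N \<inter> ?R = {}"
    using p(1) by auto
  have "(\<Sum>s\<in>sites p. ?f s) = (\<Sum>s\<in>(?N \<union> ?R) \<union> {c}. ?f s)"
    using sites by simp
  also have "\<dots> = (\<Sum>s\<in>?N \<union> ?R. ?f s) + ?f c"
    by (subst sum.union_disjoint) (use c_in in auto)
  also have "(\<Sum>s\<in>?N \<union> ?R. ?f s) = (\<Sum>s\<in>?N. ?f s) + (\<Sum>s\<in>?R. ?f s)"
    by (subst sum.union_disjoint) (use disj in auto)
  also have "(\<Sum>s\<in>?N. ?f s) = ?f 0 + (\<Sum>s\<in>?N - {0}. ?f s)"
    using N by (rule sum.remove)
  also have "?f 0 = fps_nth (sep_gf 1 r) n"
    using sep_state_insert_max(1)[OF Suc.prems zero_sites] Suc.IH by blast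
  also have "(\<Sum>s\<in>?N - {0}. ?f s) = (\<Sum>s\<in>?N - {0}. fps_nth (gap_gf (rank ?N s) (Suc r)) n)"
    using sep_state_insert_max(2)[OF Suc.prems]
    by (intro sum.cong) (auto intro: descendants_gap_state)
  \<comment> \<open>Site 0 has rank 1 and was split off, so the remaining ranks run from 2 to
    \<open>a\<close>.\<close>
  also have "\<dots> = (\<Sum>i = 2..a. fps_nth (gap_gf i (Suc r)) n)"
  proof -
    let ?g = "\<lambda>i. fps_nth (gap_gf i (Suc r)) n"
    have "rank ?N 0 = 1"
      by (rule rank_Min) (use N in auto)
    then have "?g 1 + (\<Sum>s\<in>?N - {0}. ?g (rank ?N s)) = (\<Sum>s\<in>?N. ?g (rank ?N s))"
      using sum.remove[OF N, of "\<lambda>s. ?g (rank ?N s)"] by simp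
    also have "\<dots> = (\<Sum>i = 1..a. ?g i)"
      using sum_rank[OF N(1), of ?g] p(3) by simp
    also have "\<dots> = ?g 1 + (\<Sum>i = 2..a. ?g i)"
      using sum.atLeast_Suc_atMost[OF a, of ?g] by (simp add: numeral_2_eq_2)
    finally show ?thesis by simp
  qed
  also have "(\<Sum>s\<in>?R. ?f s) = (\<Sum>s\<in>?R. fps_nth (pre_gf (Suc a)) n)"
    using sep_state_insert_max(4)[OF Suc.prems]
    by (intro sum.cong) (auto intro: descendants_pre_state)
  also have "?f c = fps_nth (sep_gf a (Suc r)) n"
    using sep_state_insert_max(3)[OF Suc.prems c_in(1,2,3)] by (rule Suc.IH)
  finally have "(\<Sum>s\<in>sites p. ?f s) = fps_nth (sep_gf 1 r + (\<Sum>i = 2..a. gap_gf i (Suc r)) +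
      sep_gf a (Suc r) + of_nat r * pre_gf (Suc a)) n"
    using p(4) by (simp add: fps_sum_nth)
  then show ?case
    by (simp add: fps_nth_rec(2)[OF sep_gf_rec[OF a]])
next
  case 0
  have "a \<ge> 1"
  proof -
    have "0 \<in> sites p - suf_sites p" "card (sites p - suf_sites p) = a"
      using 0 zero_sites by (auto simp: sep_state_def)
    then show ?thesis
      using card_0_eq[of "sites p - suf_sites p"] by (cases a) auto
  qed
  then show ?case
    by (simp add: fps_nth_rec(1)[OF sep_gf_rec])
qed

lemma descendants_decr_state:
  "decr_state m p \<Longrightarrow> of_nat (descendants n p) = fps_nth (decr_gf m) n"
proof (induction n arbitrary: m p)
  case 0
  then show ?case by (simp add: fps_nth_rec[OF decr_gf_rec])
next
  case (Suc n)
  have p: "sites p = {0..m}"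
    using Suc.prems by (simp add: decr_state_def)
  let ?f = "\<lambda>s. of_nat (descendants n (insert_max p s)) :: rat"
  have "(\<Sum>s\<in>sites p. ?f s) = ?f 0 + (\<Sum>s = 1..m. ?f s)"
    unfolding p by (subst sum.atLeast_Suc_atMost) simp_all
  also have "?f 0 = fps_nth (decr_gf (Suc m)) n"
    using decr_state_insert_max(1)[OF Suc.prems] Suc.IH by blast
  also have "(\<Sum>s = 1..m. ?f s) = (\<Sum>s = 1..m. fps_nth (sep_gf s (Suc m - s)) n)"
    using decr_state_insert_max(2)[OF Suc.prems]
    by (intro sum.cong) (auto intro: descendants_sep_state)
  finally show ?case
    by (simp add: fps_nth_rec[OF decr_gf_rec] fps_sum_nth)
qed

lemma decr_state_Nil: "decr_state 0 []"
  by (auto simp: decr_state_def bounded_list_def sites_def pre_sites_def suf_sites_def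
      ascent_def pattern_312_def)

theorem theorem3p5:
  shows "avoiders_gf {[1,2,3,4], [1,2,4,3], [3,4,1,2]} =
    (1 - 9 * fps_X + 35 * fps_X ^ 2 - 75 * fps_X ^ 3 + 98 * fps_X ^ 4
       - 78 * fps_X ^ 5 + 36 * fps_X ^ 6 - 12 * fps_X ^ 7)
    / ((1 - fps_X) ^ 6 * (1 - 2 * fps_X) ^ 2)"
proof -
  let ?d = "(1 - fps_X) ^ 6 * (1 - 2 * fps_X) ^ 2 :: rat fps"
  have "avoiders_gf {[1,2,3,4], [1,2,4,3], [3,4,1,2]} = decr_gf 0"
    unfolding avoiders_gf_def avoiders_eq card_avoiding_perms
    by (rule fps_ext) (simp add: descendants_decr_state[OF decr_state_Nil])
  \<comment> \<open>The constant coefficient is 1, so the denominator is nonzero and cancels in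
    \<open>decr_gf_0\<close>.\<close>
  moreover have "fps_nth ?d 0 \<noteq> 0"
    by (simp add: fps_power_zeroth)
  then have "?d \<noteq> 0"
    by (metis fps_zero_nth)
  ultimately show ?thesis
    unfolding decr_gf_0[symmetric] by simp
qed

end
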